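(* Let $1<p<N$, let $\mathfrak{Z}$ be a set of $p$ orthonormal vectors in $\mathbb{C}^{N}$, and let $\phi=\phi(\mathfrak{Z})$ be the associated determinantal process on $\mathcal{N}=\{1,\dots,N\}$. Suppose that $\phi$ satisfies the following property (the Conjecture): for all $n\geq 2$ and every choice $A,A_1,\dots,A_n$ of disjoint subsets of $\mathcal{N}$ such that $P\{A_i\not\subset\phi,\ \forall i=1,\dots,n\}>0$, $$P\{A\not\subset\phi\mid A_i\not\subset\phi,\ \forall i=1,\dots,n\}\leq P\{A\not\subset\phi\mid A_i\not\subset\phi,\ \forall i=1,\dots,n-1\}.$$ Let $S_1=\{A_i, i=1,\dots,n_1\}$, $S_2=\{B_i, i=1,\dots,n_2\}$, $S=\{C_i, i=1,\dots,n_3\}$ and $\tilde S=\{D_i, i=1,\dots,n_0\}$ be families of nonempty subsets of $\mathcal{N}$ such that all sets in $S_1\cup S_2\cup S\cup\tilde S$ (the four families taken together) are pairwise disjoint, and suppose $P\{D\not\subset\phi,\ \forall D\in\tilde S\}>0$. Let $\mathfrak{A},\mathfrak{B}\subset 2^{\mathcal{N}}$ be the increasing events with $S(\mathfrak{A})=S_1\cup S$ and $S(\mathfrak{B})=S_2\cup S$. Let $\psi=\{\phi\mid D\not\subset\phi,\ \forall D\in\tilde S\}$. Then $$P\{\psi\in\mathfrak{A}\circ\mathfrak{B}\}\leq P\{\psi\in\mathfrak{A}\}\times P\{\psi\in\mathfrak{B}\}.$$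
   Context: Determinantal process: for orthonormal vectors $z^{i}=(z^{i}_{1},\dots,z^{i}_{N})^{t}\in\mathbb{C}^N$, $i=1,\dots,p$, and $\mathfrak{Z}=\{z^1,\dots,z^p\}$, the process $\phi(\mathfrak{Z})$ is the random subset of $\mathcal{N}=\{1,\dots,N\}$ of cardinality $p$ whose law is given by $P\{\phi=\{i_1,\dots,i_p\}\}=\left|\det\left((z^{k}_{i_j})_{k,j=1,\dots,p}\right)\right|^{2}$ for every $p$-element subset $\{i_1,\dots,i_p\}\subset\mathcal{N}$. The notation $\psi=\{\phi\mid D\not\subset\phi,\ \forall D\in\tilde S\}$ means that $\psi$ is a random subset of $\mathcal{N}$ whose law is the conditional law of $\phi$ given the event $\{D\not\subset\phi\ \forall D\in\tilde S\}$. An event $\mathfrak{A}\subset 2^{\mathcal{N}}$ is increasing if $A\in\mathfrak{A}$ and $n\in\mathcal{N}$ imply $A\cup\{n\}\in\mathfrak{A}$. It is always assumed that $\emptyset\notin\mathfrak{A}$. For an increasing event $\mathfrak{A}$, $S(\mathfrak{A})$ denotes its set of (inclusion-)minimal elements, so that $A\in\mathfrak{A}$ if and only if $A\supset A'$ for some $A'\in S(\mathfrak{A})$. For increasing events $\mathfrak{A},\mathfrak{B}$ the disjoint intersection is $$\mathfrak{A}\circ\mathfrak{B}=\{K\subset\mathcal{N}:\ \exists\, L\in\mathfrak{A},\ M\in\mathfrak{B},\ L,M\neq\emptyset,\ L\cap M=\emptyset,\ K\supset L\cup M\}.$$ *)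

theory Defs
  imports
    "HOL-Probability.Probability_Mass_Function"
    "Jordan_Normal_Form.Conjugate"
    "Jordan_Normal_Form.Determinant"
begin

definition orthonormal_family :: "nat \<Rightarrow> complex vec list \<Rightarrow> bool" where
  "orthonormal_family N Z \<longleftrightarrow>
     set Z \<subseteq> carrier_vec N \<and>
     (\<forall>k<length Z. \<forall>l<length Z. (Z ! k) \<bullet>c (Z ! l) = (if k = l then 1 else 0))"

(* The ground set is {1..N}, whereas coordinates of vec are indexed from 0, so that the
   point i corresponds to the coordinate i - 1.  The points of I are listed in increasing
   order; the modulus of the determinant does not depend on this choice. *)
definition coordinate_matrix :: "complex vec list \<Rightarrow> nat set \<Rightarrow> complex mat" where
  "coordinate_matrix Z I =
     Matrix.mat (length Z) (length Z)
       (\<lambda>(k, j). vec_index (Z ! k) (sorted_list_of_set I ! j - 1))"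

(* phi is the law of the random set; on p-element sets it is prescribed by the minors
   (by the Cauchy-Binet formula these weights sum to 1). *)
definition determinantal_process :: "nat \<Rightarrow> complex vec list \<Rightarrow> nat set pmf \<Rightarrow> bool" where
  "determinantal_process N Z \<phi> \<longleftrightarrow>
     set_pmf \<phi> \<subseteq> {I. I \<subseteq> {1..N} \<and> card I = length Z} \<and>
     (\<forall>I. I \<subseteq> {1..N} \<and> card I = length Z \<longrightarrow>
        pmf \<phi> I = (cmod (Determinant.det (coordinate_matrix Z I)))\<^sup>2)"

definition conditional_correlation_property :: "nat \<Rightarrow> nat set pmf \<Rightarrow> bool" where
  "conditional_correlation_property N \<phi> \<longleftrightarrow>
     (\<forall>n\<ge>2. \<forall>A. \<forall>As :: nat \<Rightarrow> nat set.
        A \<subseteq> {1..N} \<longrightarrow>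
        (\<forall>i\<in>{1..n}. As i \<subseteq> {1..N}) \<longrightarrow>
        (\<forall>i\<in>{1..n}. A \<inter> As i = {}) \<longrightarrow>
        disjoint_family_on As {1..n} \<longrightarrow>
        \<P>(K in measure_pmf \<phi>. \<forall>i\<in>{1..n}. \<not> As i \<subseteq> K) > 0 \<longrightarrow>
        \<P>(K in measure_pmf \<phi>. \<not> A \<subseteq> K \<bar> \<forall>i\<in>{1..n}. \<not> As i \<subseteq> K)
          \<le> \<P>(K in measure_pmf \<phi>. \<not> A \<subseteq> K \<bar> \<forall>i\<in>{1..n-1}. \<not> As i \<subseteq> K))"

definition increasing_event :: "nat \<Rightarrow> nat set set \<Rightarrow> bool" where
  "increasing_event N \<AA> \<longleftrightarrow>
     \<AA> \<subseteq> Pow {1..N} \<and> {} \<notin> \<AA> \<and> (\<forall>A\<in>\<AA>. \<forall>n\<in>{1..N}. A \<union> {n} \<in> \<AA>)"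

definition minimal_elements :: "nat set set \<Rightarrow> nat set set" where
  "minimal_elements \<AA> = {A \<in> \<AA>. \<forall>B\<in>\<AA>. B \<subseteq> A \<longrightarrow> B = A}"

definition disjoint_intersection ::
  "nat \<Rightarrow> nat set set \<Rightarrow> nat set set \<Rightarrow> nat set set" where
  "disjoint_intersection N \<AA> \<BB> =
     {K. K \<subseteq> {1..N} \<and>
         (\<exists>L\<in>\<AA>. \<exists>M\<in>\<BB>. L \<noteq> {} \<and> M \<noteq> {} \<and> L \<inter> M = {} \<and> L \<union> M \<subseteq> K)}"

(* cond_pmf is meaningful only if the conditioning event has positive probability. *)
definition conditioned_process :: "nat set pmf \<Rightarrow> nat set set \<Rightarrow> nat set pmf" where
  "conditioned_process \<phi> T = cond_pmf \<phi> {K. \<forall>D\<in>T. \<not> D \<subseteq> K}"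

end

theory Submission
  imports Defs
begin

text \<open>
  Call a set \<open>C\<close> hit if \<open>C\<close> is contained in the random set, and missed otherwise.  Write
  \<open>f X\<close> for the probability that \<open>\<phi>\<close> misses all members of \<open>X\<close>.  The theorem rests on the
  inequality \<open>f (T \<union> X \<union> Y) * f T \<le> f (T \<union> X) * f (T \<union> Y)\<close> for disjoint subfamilies \<open>T\<close>, \<open>X\<close>, \<open>Y\<close>
  of a family of pairwise disjoint sets: given that \<open>T\<close> is missed, missing \<open>X\<close> and missing \<open>Y\<close>
  are negatively correlated.

  This inequality follows, one set at a time, from the case of singletons \<open>X\<close> and \<open>Y\<close>
  (\<open>negatively_correlated_Un\<close>).  For nonempty \<open>T\<close> the singleton case is the assumed conditional
  correlation property.  That property always conditions on at least one set, hence is silent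
  about \<open>T = {}\<close>, where the inequality says that \<open>P (A \<union> B \<subseteq> \<phi>) \<le> P (A \<subseteq> \<phi>) * P (B \<subseteq> \<phi>)\<close>.  Here the
  determinantal law enters: \<open>P (A \<subseteq> \<phi>)\<close> is the principal minor on \<open>A\<close> of an orthogonal projection
  (\<open>determinantal_process_prob_superset\<close>), and principal minors of a projection are
  submultiplicative by Fischer's inequality (\<open>minor_Un_le\<close>).  Both facts are proved with
  Schur complements: the complement of a diagonal entry in a projection of rank \<open>q + 1\<close> is a
  projection of rank \<open>q\<close>, which permits induction on the rank or on the size of the minor.

  Since the generating sets are nonempty and pairwise disjoint, the disjoint intersection of
  \<open>\<AA>\<close> and \<open>\<BB>\<close> occurs only if a generator of \<open>\<AA>\<close> and a different generator of \<open>\<BB>\<close> are both hit.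
  The bound is then obtained by induction on the number of common generators
  (\<open>prob_hits_distinct_le\<close>).  If there is none, it is the negative correlation above.  A common
  generator \<open>c\<close> is removed by splitting according to whether \<open>c\<close> is hit: if it is missed, it moves
  to the sets on which we condition and the induction hypothesis applies; if it is hit, one other
  generator must be hit as well, and this is negatively correlated with hitting \<open>c\<close>.
\<close>

section \<open>Principal minors and Schur complements\<close>

definition kernel_det :: "('a \<Rightarrow> 'a \<Rightarrow> complex) \<Rightarrow> 'a list \<Rightarrow> complex" where
  "kernel_det K xs =
     Determinant.det (Matrix.mat (length xs) (length xs) (\<lambda>(i, j). K (xs ! i) (xs ! j)))"

text \<open>
  The Schur complement of the diagonal entry at \<open>a\<close>.  If this entry vanishes, division by zero
  gives \<open>deflate K a = K\<close>; where this case is not excluded, the result is multiplied by \<open>K a a\<close>.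
\<close>
definition deflate :: "('a \<Rightarrow> 'a \<Rightarrow> complex) \<Rightarrow> 'a \<Rightarrow> 'a \<Rightarrow> 'a \<Rightarrow> complex" where
  "deflate K a x y = K x y - K x a * K a y / K a a"

text \<open>
  The real part loses nothing for Hermitian kernels and yields a quantity that can be compared with
  probabilities.
\<close>
definition minor :: "('a::linorder \<Rightarrow> 'a \<Rightarrow> complex) \<Rightarrow> 'a set \<Rightarrow> real" where
  "minor K I = Re (kernel_det K (sorted_list_of_set I))"

text \<open>
  Reordering the list permutes rows and columns simultaneously, and the two signs cancel.
  Hence any chosen point can be moved to the front.
\<close>
lemma kernel_det_cong_mset:
  assumes "mset xs = mset ys"
  shows "kernel_det K xs = kernel_det K ys"
proof -
  define n where "n = length ys"
  obtain \<pi> where perm: "\<pi> permutes {..<n}" and xs: "permute_list \<pi> ys = xs"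
    using mset_eq_permutation[OF assms] unfolding n_def by blast
  have len: "length xs = n"
    using xs n_def by auto
  have perm': "\<pi> permutes {0..<n}"
    using perm by (simp add: atLeast0LessThan)
  have pl: "\<pi> i < n" if "i < n" for i
    using permutes_in_image[OF perm, of i] that by auto
  have nth: "xs ! i = ys ! \<pi> i" if "i < n" for i
    using permute_list_nth[of \<pi> ys i] perm that xs n_def by auto
  define A where "A = Matrix.mat n n (\<lambda>(i, j). K (ys ! i) (ys ! j))"
  define B where "B = Matrix.mat n n (\<lambda>(i, j). A $$ (\<pi> i, j))"
  define C where "C = Matrix.mat n n (\<lambda>(i, j). (transpose_mat B) $$ (\<pi> i, j))"
  have carr: "A \<in> carrier_mat n n" "B \<in> carrier_mat n n" "transpose_mat B \<in> carrier_mat n n"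
    "C \<in> carrier_mat n n"
    by (auto simp: A_def B_def C_def)
  have "Determinant.det B = signof \<pi> * Determinant.det A"
    unfolding B_def by (rule det_permute_rows[OF carr(1) perm'])
  moreover have "Determinant.det C = signof \<pi> * Determinant.det (transpose_mat B)"
    unfolding C_def by (rule det_permute_rows[OF carr(3) perm'])
  ultimately have "Determinant.det C = Determinant.det A"
    using det_transpose[OF carr(2)] by (auto simp: sign_def)
  moreover have "transpose_mat C = Matrix.mat n n (\<lambda>(i, j). K (xs ! i) (xs ! j))"
    by (rule eq_matI) (auto simp: C_def B_def A_def pl nth)
  ultimately show ?thesis
    using det_transpose[OF carr(4)] len unfolding kernel_det_def A_def n_def by simp
qed

text \<open>
  Gaussian elimination of the first column: the matrix is the product of a unipotent lower
  triangular matrix and a block upper triangular one with the Schur complement in its corner.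
\<close>
lemma kernel_det_Cons:
  assumes "K a a \<noteq> 0"
  shows "kernel_det K (a # xs) = K a a * kernel_det (deflate K a) xs"
proof -
  define n where "n = length xs"
  define A where "A = Matrix.mat 1 1 (\<lambda>_. K a a)"
  define R where "R = Matrix.mat 1 n (\<lambda>(i, j). K a (xs ! j))"
  define c where "c = Matrix.mat n 1 (\<lambda>(i, j). K (xs ! i) a / K a a)"
  define S where "S = Matrix.mat n n (\<lambda>(i, j). deflate K a (xs ! i) (xs ! j))"
  \<comment> \<open>The multipliers of the elimination form the column \<open>c\<close>.\<close>
  define L where "L = four_block_mat (1\<^sub>m 1) (0\<^sub>m 1 n) c (1\<^sub>m n)"
  define U where "U = four_block_mat A R (0\<^sub>m n 1) S"
  have carr: "A \<in> carrier_mat 1 1" "R \<in> carrier_mat 1 n" "c \<in> carrier_mat n 1"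
    "S \<in> carrier_mat n n"
    by (auto simp: A_def R_def c_def S_def)
  have prod: "L * U = four_block_mat A R (c * A) (c * R + S)"
    unfolding L_def U_def
    using carr by (subst mult_four_block_mat[of _ 1 1 _ n _ n _ _ 1 _ n]) auto
  have "Matrix.mat (length (a # xs)) (length (a # xs)) (\<lambda>(i, j). K ((a # xs) ! i) ((a # xs) ! j)) = L * U"
    unfolding prod
  proof (rule eq_matI)
    fix i j
    assume "i < dim_row (four_block_mat A R (c * A) (c * R + S))"
      and "j < dim_col (four_block_mat A R (c * A) (c * R + S))"
    then have "i < Suc n" "j < Suc n"
      using carr by auto
    then show "Matrix.mat (length (a # xs)) (length (a # xs))
        (\<lambda>(i, j). K ((a # xs) ! i) ((a # xs) ! j)) $$ (i, j) =
        four_block_mat A R (c * A) (c * R + S) $$ (i, j)"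
      using assms
      by (cases i; cases j)
        (auto simp: A_def R_def c_def S_def deflate_def n_def scalar_prod_def)
  qed (use carr in \<open>auto simp: n_def\<close>)
  moreover have "Determinant.det (L * U) = Determinant.det L * Determinant.det U"
    by (rule det_mult[of _ "Suc n"]) (use carr in \<open>auto simp: L_def U_def\<close>)
  moreover have "Determinant.det L = 1"
    unfolding L_def
    by (subst det_four_block_mat_upper_right_zero[OF _ refl, of _ 1 _ n]) (use carr in auto)
  moreover have "Determinant.det U = K a a * Determinant.det S"
    unfolding U_def
    by (subst det_four_block_mat_lower_left_zero_col[OF _ _ refl, of _ _ n])
      (use carr in \<open>auto simp: A_def det_single\<close>)
  ultimately show ?thesis
    by (simp add: kernel_det_def S_def n_def)
qed

section \<open>Minors of orthogonal projections\<close>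

text \<open>
  The matrix of an orthogonal projection of rank \<open>q\<close>, indexed by \<open>V\<close>: for a Hermitian idempotent
  the rank equals the trace, and the trace is easier to follow through Schur complements.
\<close>
definition projection_kernel ::
  "'a set \<Rightarrow> nat \<Rightarrow> ('a \<Rightarrow> 'a \<Rightarrow> complex) \<Rightarrow> bool" where
  "projection_kernel V q K \<longleftrightarrow>
     finite V \<and>
     (\<forall>x\<in>V. \<forall>y\<in>V. K y x = cnj (K x y)) \<and>
     (\<forall>x\<in>V. \<forall>y\<in>V. (\<Sum>z\<in>V. K x z * K z y) = K x y) \<and>
     (\<Sum>x\<in>V. K x x) = of_nat q"

lemma projection_kernelD:
  assumes "projection_kernel V q K"
  shows projection_kernel_finite: "finite V"
    and projection_kernel_hermitian: "x \<in> V \<Longrightarrow> y \<in> V \<Longrightarrow> K y x = cnj (K x y)"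
    and projection_kernel_idem: "x \<in> V \<Longrightarrow> y \<in> V \<Longrightarrow> (\<Sum>z\<in>V. K x z * K z y) = K x y"
    and projection_kernel_trace: "(\<Sum>x\<in>V. K x x) = of_nat q"
  using assms unfolding projection_kernel_def by blast+

text \<open>
  Idempotence and symmetry turn a diagonal entry into the squared norm of its row.  This single
  identity replaces positive semidefiniteness: diagonal entries are nonnegative, and a vanishing one
  annihilates its whole row.
\<close>
lemma projection_kernel_diag:
  assumes "projection_kernel V q K" and "a \<in> V"
  shows "K a a = of_real (\<Sum>z\<in>V. (cmod (K a z))\<^sup>2)"
proof -
  have "K a z * K z a = of_real ((cmod (K a z))\<^sup>2)" if "z \<in> V" for z
    using projection_kernel_hermitian[OF assms(1) assms(2) that] complex_norm_square[of "K a z"]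
    by simp
  then show ?thesis
    using projection_kernel_idem[OF assms(1) assms(2) assms(2)] by simp
qed

lemma projection_kernel_diag_real:
  assumes "projection_kernel V q K" and "a \<in> V"
  shows "K a a = of_real (Re (K a a))" and "0 \<le> Re (K a a)"
  using projection_kernel_diag[OF assms] by (simp_all add: sum_nonneg)

lemma projection_kernel_diag_eq_0:
  assumes "projection_kernel V q K" and "a \<in> V" and "K a a = 0" and "z \<in> V"
  shows "K a z = 0"
proof -
  have "(\<Sum>z\<in>V. (cmod (K a z))\<^sup>2) = 0"
    using projection_kernel_diag[OF assms(1,2)] assms(3) by (metis of_real_eq_0_iff)
  then show ?thesis
    using assms(4) projection_kernel_finite[OF assms(1)] by (simp add: sum_nonneg_eq_0_iff)
qed

lemma projection_kernel_Re_trace: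
  assumes "projection_kernel V q K"
  shows "(\<Sum>x\<in>V. Re (K x x)) = real q"
  using arg_cong[OF projection_kernel_trace[OF assms], of Re] by simp

lemma projection_kernel_0_diag:
  assumes "projection_kernel V 0 K" and "a \<in> V"
  shows "K a a = 0"
proof -
  have "Re (K a a) = 0"
    using projection_kernel_Re_trace[OF assms(1)] projection_kernel_diag_real(2)[OF assms(1)]
      projection_kernel_finite[OF assms(1)] assms(2)
    by (simp add: sum_nonneg_eq_0_iff)
  then show ?thesis
    using projection_kernel_diag_real(1)[OF assms] by simp
qed

text \<open>
  With \<open>v = K e\<^sub>a\<close>, the Schur complement is \<open>K\<close> minus the orthogonal projection onto the line
  spanned by \<open>v\<close>, and \<open>v\<close> lies in the range of \<open>K\<close>.
\<close>
lemma projection_kernel_deflate: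
  assumes K: "projection_kernel V (Suc q) K" and a: "a \<in> V" and nz: "K a a \<noteq> 0"
  shows "projection_kernel V q (deflate K a)"
proof -
  note idem = projection_kernel_idem[OF K] and herm = projection_kernel_hermitian[OF K]
  have "deflate K a y x = cnj (deflate K a x y)" if "x \<in> V" "y \<in> V" for x y
    using herm[OF that] herm[OF that(1) a] herm[OF a that(2)] herm[OF a a]
    by (simp add: deflate_def mult.commute)
  moreover have "(\<Sum>z\<in>V. deflate K a x z * deflate K a z y) = deflate K a x y"
    if "x \<in> V" "y \<in> V" for x y
  proof -
    have "deflate K a x z * deflate K a z y =
        K x z * K z y - K a y / K a a * (K x z * K z a) - K x a / K a a * (K a z * K z y)
          + K x a * K a y / (K a a)\<^sup>2 * (K a z * K z a)" for z
      using nz by (simp add: deflate_def field_simps power2_eq_square)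
    then have "(\<Sum>z\<in>V. deflate K a x z * deflate K a z y) =
        K x y - K a y / K a a * K x a - K x a / K a a * K a y
          + K x a * K a y / (K a a)\<^sup>2 * K a a"
      by (simp only: sum.distrib sum_subtractf sum_distrib_left[symmetric]
          idem[OF that] idem[OF that(1) a] idem[OF a that(2)] idem[OF a a])
    also have "\<dots> = deflate K a x y"
      using nz by (simp add: deflate_def field_simps power2_eq_square)
    finally show ?thesis .
  qed
  moreover have "(\<Sum>x\<in>V. deflate K a x x) = of_nat q"
  proof -
    have "(\<Sum>x\<in>V. deflate K a x x) = (\<Sum>x\<in>V. K x x) - (\<Sum>x\<in>V. K a x * K x a) / K a a"
      by (simp add: deflate_def sum_subtractf sum_divide_distrib mult.commute)
    then show ?thesis
      using idem[OF a a] projection_kernel_trace[OF K] nz by simp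
  qed
  ultimately show ?thesis
    using projection_kernel_finite[OF K] unfolding projection_kernel_def by blast
qed

lemma minor_empty [simp]: "minor K {} = 1"
  by (simp add: minor_def kernel_det_def)

text \<open>
  The recursion from which all further facts about minors are derived.  For \<open>K a a = 0\<close> both sides
  vanish, since then the row of \<open>a\<close> is zero.
\<close>
lemma minor_remove:
  assumes K: "projection_kernel V q K" and "I \<subseteq> V" and a: "a \<in> I"
  shows "minor K I = Re (K a a) * minor (deflate K a) (I - {a})"
proof -
  let ?xs = "sorted_list_of_set (I - {a})"
  have fin: "finite I"
    using finite_subset[OF assms(2) projection_kernel_finite[OF K]] .
  have aV: "a \<in> V"
    using assms by blast
  have "mset (sorted_list_of_set I) = mset (a # ?xs)"
    using fin a by (subst set_eq_iff_mset_eq_distinct[symmetric]) auto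
  then have eq: "kernel_det K (sorted_list_of_set I) = kernel_det K (a # ?xs)"
    by (rule kernel_det_cong_mset)
  show ?thesis
  proof (cases "K a a = 0")
    case False
    then have "kernel_det K (sorted_list_of_set I)
        = of_real (Re (K a a)) * kernel_det (deflate K a) ?xs"
      using eq kernel_det_Cons[of K a ?xs] projection_kernel_diag_real(1)[OF K aV] by simp
    then show ?thesis
      by (simp add: minor_def)
  next
    case True
    let ?n = "Suc (length ?xs)"
    let ?M = "Matrix.mat ?n ?n (\<lambda>(i, j). K ((a # ?xs) ! i) ((a # ?xs) ! j))"
    have "set (a # ?xs) \<subseteq> V"
      using fin assms(2) aV by auto
    then have "K a ((a # ?xs) ! j) = 0" if "j < ?n" for j
      using projection_kernel_diag_eq_0[OF K aV True, of "(a # ?xs) ! j"] that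
        nth_mem[of j "a # ?xs"] by auto
    then have row: "?M $$ (0, j) = 0" if "j < ?n" for j
      using that by simp
    have "Determinant.det ?M = 0"
    proof (subst det_def'[of _ ?n])
      have "(\<Prod>i = 0..<?n. ?M $$ (i, \<pi> i)) = 0" if "\<pi> permutes {0..<?n}" for \<pi>
      proof (rule prod_zero)
        have "\<pi> 0 < ?n"
          using permutes_in_image[OF that, of 0] by simp
        then show "\<exists>i\<in>{0..<?n}. ?M $$ (i, \<pi> i) = 0"
          using row by (intro bexI[of _ 0]) simp_all
      qed simp
      then show "(\<Sum>\<pi> | \<pi> permutes {0..<?n}. signof \<pi> * (\<Prod>i = 0..<?n. ?M $$ (i, \<pi> i))) = 0"
        by (intro sum.neutral) auto
    qed simp
    then show ?thesis
      using True eq by (simp add: minor_def kernel_det_def)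
  qed
qed

lemma minor_eq_0:
  assumes "projection_kernel V q K" and "I \<subseteq> V" and "a \<in> I" and "K a a = 0"
  shows "minor K I = 0"
  using minor_remove[OF assms(1-3)] assms(4) by simp

lemma minor_singleton:
  assumes "projection_kernel V q K" and "a \<in> V"
  shows "minor K {a} = Re (K a a)"
  using minor_remove[OF assms(1), of "{a}" a] assms(2) by simp

lemma projection_kernel_rank_Suc:
  assumes "projection_kernel V q K" and "a \<in> V" and "K a a \<noteq> 0"
  obtains q' where "q = Suc q'" and "projection_kernel V q' (deflate K a)"
proof (cases q)
  case 0
  then show ?thesis
    using projection_kernel_0_diag[of V K a] assms by simp
next
  case (Suc q')
  then show ?thesis
    using projection_kernel_deflate[of V q' K a] assms that by simp
qed

lemma minor_nonneg:
  assumes "projection_kernel V q K" and "I \<subseteq> V"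
  shows "0 \<le> minor K I"
proof -
  have "finite I"
    using finite_subset[OF assms(2) projection_kernel_finite[OF assms(1)]] .
  then show ?thesis
    using assms
  proof (induction I arbitrary: K q rule: finite_induct)
    case empty
    show ?case by simp
  next
    case (insert a I)
    then have a: "a \<in> V"
      by blast
    show ?case
    proof (cases "K a a = 0")
      case True
      then show ?thesis
        using minor_eq_0[OF insert.prems, of a] by simp
    next
      case False
      then obtain q' where "projection_kernel V q' (deflate K a)"
        using projection_kernel_rank_Suc[OF insert.prems(1) a] by blast
      then have "0 \<le> minor (deflate K a) I"
        using insert by blast
      then show ?thesis
        using minor_remove[OF insert.prems, of a] projection_kernel_diag_real(2)[OF insert.prems(1) a]
          insert.hyps by simp
    qed
  qed
qed

text \<open>
  Fischer's inequality for a single point.  Eliminating a point \<open>b\<close> of \<open>B\<close> on both sides leaves the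
  same claim for the Schur complement, whose diagonal entry at \<open>a\<close> is smaller than that of \<open>K\<close> by
  a multiple of the squared modulus of \<open>K a b\<close>.
\<close>
lemma minor_insert_le:
  assumes "projection_kernel V q K" and "B \<subseteq> V" and "a \<in> V" and "a \<notin> B"
  shows "minor K (insert a B) \<le> Re (K a a) * minor K B"
proof -
  have "finite B"
    using finite_subset[OF assms(2) projection_kernel_finite[OF assms(1)]] .
  then show ?thesis
    using assms
  proof (induction B arbitrary: K q rule: finite_induct)
    case empty
    then show ?case
      by (simp add: minor_singleton)
  next
    case (insert b B)
    then have b: "b \<in> V" and "a \<noteq> b" and B: "B \<subseteq> V" "a \<notin> B"
      by auto
    have sub: "insert a (insert b B) \<subseteq> V"
      using insert.prems by blast
    note K = insert.prems(1)
    have rem: "minor K (insert a (insert b B)) = Re (K b b) * minor (deflate K b) (insert a B)"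
      "minor K (insert b B) = Re (K b b) * minor (deflate K b) B"
      using minor_remove[OF K sub, of b] minor_remove[OF K insert.prems(2), of b]
        \<open>a \<noteq> b\<close> insert.hyps by (simp_all add: insert_Diff_if)
    show ?case
    proof (cases "K b b = 0")
      case True
      then show ?thesis
        using rem by simp
    next
      case False
      then obtain q' where K': "projection_kernel V q' (deflate K b)"
        using projection_kernel_rank_Suc[OF K b] by blast
      have pos: "0 \<le> Re (K b b)"
        using projection_kernel_diag_real(2)[OF K b] .
      have "deflate K b a a = of_real (Re (K a a) - (cmod (K a b))\<^sup>2 / Re (K b b))"
        using projection_kernel_diag_real(1)[OF K insert.prems(3)] projection_kernel_diag_real(1)[OF K b]
          projection_kernel_hermitian[OF K insert.prems(3) b]
        unfolding deflate_def by (metis complex_norm_square of_real_diff of_real_divide)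
      then have le: "Re (deflate K b a a) \<le> Re (K a a)"
        using pos by simp
      have "minor K (insert a (insert b B))
          \<le> Re (K b b) * (Re (deflate K b a a) * minor (deflate K b) B)"
        unfolding rem by (intro mult_left_mono insert.IH[OF K' B(1) insert.prems(3) B(2)] pos)
      also have "\<dots> \<le> Re (K b b) * (Re (K a a) * minor (deflate K b) B)"
        by (intro mult_left_mono mult_right_mono le pos minor_nonneg[OF K' B(1)])
      finally show ?thesis
        unfolding rem by (simp add: mult.left_commute)
    qed
  qed
qed

text \<open>
  Fischer's inequality.  Eliminating a point \<open>a\<close> of \<open>A\<close> replaces \<open>K\<close> by \<open>deflate K a\<close> also in the
  factor for \<open>B\<close>; by the case of a single point this can only decrease that factor.
\<close>
lemma minor_Un_le:
  assumes "projection_kernel V q K" and "A \<subseteq> V" and "B \<subseteq> V" and "A \<inter> B = {}"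
  shows "minor K (A \<union> B) \<le> minor K A * minor K B"
proof -
  have "finite A"
    using finite_subset[OF assms(2) projection_kernel_finite[OF assms(1)]] .
  then show ?thesis
    using assms
  proof (induction A arbitrary: K q rule: finite_induct)
    case empty
    then show ?case by simp
  next
    case (insert a A)
    then have a: "a \<in> V" "a \<notin> B" and A: "A \<subseteq> V" "A \<inter> B = {}"
      by auto
    have sub: "insert a A \<union> B \<subseteq> V" "insert a B \<subseteq> V"
      using insert.prems by blast+
    note K = insert.prems(1)
    have rem: "minor K (insert a A \<union> B) = Re (K a a) * minor (deflate K a) (A \<union> B)"
      "minor K (insert a A) = Re (K a a) * minor (deflate K a) A"
      "minor K (insert a B) = Re (K a a) * minor (deflate K a) B"
      using minor_remove[OF K sub(1), of a] minor_remove[OF K insert.prems(2), of a]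
        minor_remove[OF K sub(2), of a] a insert.hyps by simp_all
    show ?case
    proof (cases "K a a = 0")
      case True
      then show ?thesis
        using rem by simp
    next
      case False
      then obtain q' where K': "projection_kernel V q' (deflate K a)"
        using projection_kernel_rank_Suc[OF K a(1)] by blast
      have pos: "0 < Re (K a a)"
        using projection_kernel_diag_real[OF K a(1)] False
        by (metis less_eq_real_def of_real_0)
      have le: "minor (deflate K a) B \<le> minor K B"
        using minor_insert_le[OF K insert.prems(3) a] pos unfolding rem by simp
      have "minor K (insert a A \<union> B)
          \<le> Re (K a a) * (minor (deflate K a) A * minor (deflate K a) B)"
        unfolding rem using pos
        by (intro mult_left_mono insert.IH[OF K' A(1) insert.prems(3) A(2)]) simp
      also have "\<dots> \<le> Re (K a a) * (minor (deflate K a) A * minor K B)"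
        using pos by (intro mult_left_mono le minor_nonneg[OF K' A(1)]) simp
      finally show ?thesis
        unfolding rem by (simp add: mult.assoc)
    qed
  qed
qed

text \<open>
  The minors of full rank are the weights of a point process, and this identity computes its
  correlation functions; for \<open>A = {}\<close> it says that the total mass is 1.  If \<open>A\<close> contains a point
  \<open>a\<close>, eliminating \<open>a\<close> from every summand lowers the rank by one.  The case \<open>A = {}\<close> of the same rank
  follows by counting each summand once for every point of its index set, which turns
  \<open>q\<close> times the sum into the trace of \<open>K\<close>.
\<close>
lemma sum_minors:
  assumes "projection_kernel V q K" and "A \<subseteq> V"
  shows "(\<Sum>I | A \<subseteq> I \<and> I \<subseteq> V \<and> card I = q. minor K I) = minor K A"
  using assms
proof (induction q arbitrary: K A)
  case 0
  have fin: "finite V"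
    using projection_kernel_finite[OF 0(1)] .
  have "{I. A \<subseteq> I \<and> I \<subseteq> V \<and> card I = 0} = (if A = {} then {{}} else {})"
    using finite_subset[OF _ fin] by (auto simp: card_eq_0_iff)
  moreover have "minor K A = 0" if nonempty: "A \<noteq> {}"
  proof -
    obtain a where a: "a \<in> A" "a \<in> V"
      using nonempty 0(2) by blast
    show ?thesis
      using minor_eq_0[OF 0 a(1)] projection_kernel_0_diag[OF 0(1) a(2)] by blast
  qed
  ultimately show ?case
    by simp
next
  case (Suc q)
  note K = Suc.prems(1)
  have fin: "finite V"
    using projection_kernel_finite[OF K] .
  have step: "(\<Sum>I | A \<subseteq> I \<and> I \<subseteq> V \<and> card I = Suc q. minor K I) = minor K A"
    if "a \<in> A" "A \<subseteq> V" for a A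
  proof (cases "K a a = 0")
    case True
    then have "minor K I = 0" if "A \<subseteq> I" "I \<subseteq> V" for I
      using that \<open>a \<in> A\<close> minor_eq_0[OF K] by blast
    then show ?thesis
      using that by simp
  next
    case False
    have a: "a \<in> V"
      using that by blast
    have K': "projection_kernel V q (deflate K a)"
      using projection_kernel_deflate[OF K a False] .
    have "(\<Sum>I | A \<subseteq> I \<and> I \<subseteq> V \<and> card I = Suc q. minor K I)
        = (\<Sum>J | A - {a} \<subseteq> J \<and> J \<subseteq> V \<and> card J = q \<and> a \<notin> J.
             Re (K a a) * minor (deflate K a) J)"
    proof (rule sum.reindex_bij_witness[of _ "insert a" "\<lambda>I. I - {a}"])
      fix I assume "I \<in> {I. A \<subseteq> I \<and> I \<subseteq> V \<and> card I = Suc q}"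
      then have I: "A \<subseteq> I" "I \<subseteq> V" "card I = Suc q" "a \<in> I"
        using that by auto
      then show "insert a (I - {a}) = I"
        and "I - {a} \<in> {J. A - {a} \<subseteq> J \<and> J \<subseteq> V \<and> card J = q \<and> a \<notin> J}"
        by auto
      show "Re (K a a) * minor (deflate K a) (I - {a}) = minor K I"
        using minor_remove[OF K I(2,4)] by simp
    next
      fix J assume "J \<in> {J. A - {a} \<subseteq> J \<and> J \<subseteq> V \<and> card J = q \<and> a \<notin> J}"
      then show "insert a J - {a} = J"
        and "insert a J \<in> {I. A \<subseteq> I \<and> I \<subseteq> V \<and> card I = Suc q}"
        using finite_subset[OF _ fin, of J] a by auto
    qed
    \<comment> \<open>Index sets containing \<open>a\<close> contribute nothing, because the row of \<open>a\<close> was eliminated.\<close>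
    also have "\<dots> = (\<Sum>J | A - {a} \<subseteq> J \<and> J \<subseteq> V \<and> card J = q.
        Re (K a a) * minor (deflate K a) J)"
    proof (rule sum.mono_neutral_left)
      show "\<forall>J\<in>{J. A - {a} \<subseteq> J \<and> J \<subseteq> V \<and> card J = q} -
          {J. A - {a} \<subseteq> J \<and> J \<subseteq> V \<and> card J = q \<and> a \<notin> J}.
          Re (K a a) * minor (deflate K a) J = 0"
        using minor_eq_0[OF K', of _ a] False by (auto simp: deflate_def)
    qed (use fin in auto)
    also have "\<dots> = Re (K a a) * minor (deflate K a) (A - {a})"
      using Suc.IH[OF K', of "A - {a}"] that by (auto simp flip: sum_distrib_left)
    also have "\<dots> = minor K A"
      using minor_remove[OF K that(2,1)] by simp
    finally show ?thesis .
  qed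
  show ?case
  proof (cases "A = {}")
    case False
    then show ?thesis
      using step Suc.prems(2) by blast
  next
    case True
    let ?F = "{I. I \<subseteq> V \<and> card I = Suc q}"
    have "real (Suc q) * (\<Sum>I\<in>?F. minor K I) = (\<Sum>I\<in>?F. \<Sum>a | a \<in> V \<and> a \<in> I. minor K I)"
      unfolding sum_distrib_left
    proof (rule sum.cong)
      fix I assume "I \<in> ?F"
      moreover from this have "{a. a \<in> V \<and> a \<in> I} = I"
        by blast
      ultimately show "real (Suc q) * minor K I = (\<Sum>a | a \<in> V \<and> a \<in> I. minor K I)"
        by simp
    qed simp
    also have "\<dots> = (\<Sum>a\<in>V. \<Sum>I | I \<in> ?F \<and> a \<in> I. minor K I)"
      using fin by (intro sum.swap_restrict) auto
    also have "\<dots> = (\<Sum>a\<in>V. Re (K a a))"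
    proof (rule sum.cong)
      fix a assume a: "a \<in> V"
      have "{I. I \<in> ?F \<and> a \<in> I} = {I. {a} \<subseteq> I \<and> I \<subseteq> V \<and> card I = Suc q}"
        by auto
      then show "(\<Sum>I | I \<in> ?F \<and> a \<in> I. minor K I) = Re (K a a)"
        using step[of a "{a}"] a minor_singleton[OF K a] by simp
    qed simp
    also have "\<dots> = real (Suc q)"
      using projection_kernel_Re_trace[OF K] .
    finally have "(\<Sum>I\<in>?F. minor K I) = 1"
      by simp
    then show ?thesis
      using True by simp
  qed
qed

section \<open>Correlations of the determinantal process\<close>

text \<open>
  The Gram matrix of the columns of the matrix with rows \<open>Z\<close>.  Its index is a point of the ground
  set, which corresponds to the coordinate one lower.
\<close>
definition column_kernel :: "complex vec list \<Rightarrow> nat \<Rightarrow> nat \<Rightarrow> complex" where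
  "column_kernel Z x y =
     (\<Sum>k<length Z. cnj (vec_index (Z ! k) (x - 1)) * vec_index (Z ! k) (y - 1))"

text \<open>
  With the vectors of \<open>Z\<close> as the rows of a matrix \<open>M\<close>, the kernel is \<open>M\<^sup>* M\<close>; orthonormality is
  \<open>M M\<^sup>* = 1\<close>, which makes it an idempotent of trace \<open>length Z\<close>.
\<close>
lemma projection_kernel_column_kernel:
  assumes "orthonormal_family N Z"
  shows "projection_kernel {1..N} (length Z) (column_kernel Z)"
proof -
  let ?p = "length Z"
  let ?z = "\<lambda>k x. vec_index (Z ! k) (x - 1)"
  have orth: "(\<Sum>x\<in>{1..N}. ?z k x * cnj (?z l x)) = (if k = l then 1 else 0)"
    if "k < ?p" "l < ?p" for k l
  proof -
    have "Z ! l \<in> carrier_vec N"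
      using assms that nth_mem unfolding orthonormal_family_def by blast
    then have "(Z ! k) \<bullet>c (Z ! l) = (\<Sum>i<N. vec_index (Z ! k) i * cnj (vec_index (Z ! l) i))"
      by (simp add: scalar_prod_def atLeast0LessThan)
    also have "\<dots> = (\<Sum>x\<in>{1..N}. ?z k x * cnj (?z l x))"
      by (simp add: sum.atLeast1_atMost_eq)
    finally show ?thesis
      using assms that unfolding orthonormal_family_def by simp
  qed
  have "(\<Sum>w\<in>{1..N}. column_kernel Z x w * column_kernel Z w y) = column_kernel Z x y" for x y
  proof -
    have "(\<Sum>w\<in>{1..N}. column_kernel Z x w * column_kernel Z w y) =
        (\<Sum>w\<in>{1..N}. \<Sum>k<?p. \<Sum>l<?p. cnj (?z k x) * ?z l y * (?z k w * cnj (?z l w)))"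
      by (simp add: column_kernel_def sum_product mult_ac)
    also have "\<dots> = (\<Sum>k<?p. \<Sum>w\<in>{1..N}. \<Sum>l<?p. cnj (?z k x) * ?z l y * (?z k w * cnj (?z l w)))"
      by (rule sum.swap)
    also have "\<dots> = (\<Sum>k<?p. \<Sum>l<?p. \<Sum>w\<in>{1..N}. cnj (?z k x) * ?z l y * (?z k w * cnj (?z l w)))"
      by (intro sum.cong refl sum.swap)
    also have "\<dots> = (\<Sum>k<?p. \<Sum>l<?p. cnj (?z k x) * ?z l y * (if k = l then 1 else 0))"
      using orth by (simp add: sum_distrib_left[symmetric] del: One_nat_def)
    also have "\<dots> = column_kernel Z x y"
      by (simp add: column_kernel_def if_distrib cong: if_cong)
    finally show ?thesis .
  qed
  moreover have "(\<Sum>x\<in>{1..N}. column_kernel Z x x) = of_nat ?p"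
  proof -
    have "(\<Sum>x\<in>{1..N}. column_kernel Z x x) = (\<Sum>k<?p. \<Sum>x\<in>{1..N}. ?z k x * cnj (?z k x))"
      unfolding column_kernel_def by (subst sum.swap) (simp add: mult.commute)
    also have "\<dots> = (\<Sum>k<?p. 1)"
      using orth by (intro sum.cong) (simp_all del: One_nat_def)
    finally show ?thesis by simp
  qed
  ultimately show ?thesis
    by (simp add: projection_kernel_def column_kernel_def mult.commute)
qed

lemma minor_column_kernel:
  assumes "card I = length Z"
  shows "minor (column_kernel Z) I = (cmod (Determinant.det (coordinate_matrix Z I)))\<^sup>2"
proof -
  interpret cnj: comm_ring_hom cnj
    by unfold_locales auto
  let ?p = "length Z"
  let ?M = "coordinate_matrix Z I"
  let ?A = "transpose_mat (map_mat cnj ?M)"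
  have carr: "?M \<in> carrier_mat ?p ?p" "map_mat cnj ?M \<in> carrier_mat ?p ?p" "?A \<in> carrier_mat ?p ?p"
    by (auto simp: coordinate_matrix_def)
  have len: "length (sorted_list_of_set I) = ?p"
    using assms by simp
  have "Matrix.mat ?p ?p (\<lambda>(i, j). column_kernel Z (sorted_list_of_set I ! i) (sorted_list_of_set I ! j))
      = ?A * ?M"
    by (rule eq_matI)
      (auto simp: coordinate_matrix_def column_kernel_def scalar_prod_def atLeast0LessThan)
  then have "kernel_det (column_kernel Z) (sorted_list_of_set I)
      = Determinant.det ?A * Determinant.det ?M"
    using det_mult[OF carr(3,1)] len by (simp add: kernel_det_def)
  also have "\<dots> = cnj (Determinant.det ?M) * Determinant.det ?M"
    using det_transpose[OF carr(2)] by simp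
  also have "\<dots> = of_real ((cmod (Determinant.det ?M))\<^sup>2)"
    by (simp only: complex_norm_square mult.commute)
  finally show ?thesis
    by (simp add: minor_def)
qed

text \<open>
  The point weights are the minors of full rank of a projection, so that \<open>sum_minors\<close> evaluates the
  sum over all outcomes containing \<open>A\<close>.
\<close>
lemma determinantal_process_prob_superset:
  assumes "orthonormal_family N Z" and "determinantal_process N Z \<phi>" and "A \<subseteq> {1..N}"
  shows "measure_pmf.prob \<phi> {K. A \<subseteq> K} = minor (column_kernel Z) A"
proof -
  let ?F = "{I. A \<subseteq> I \<and> I \<subseteq> {1..N} \<and> card I = length Z}"
  have supp: "set_pmf \<phi> \<subseteq> {I. I \<subseteq> {1..N} \<and> card I = length Z}"
    using assms(2) unfolding determinantal_process_def by blast
  have "{K. A \<subseteq> K} \<inter> set_pmf \<phi> = ?F \<inter> set_pmf \<phi>"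
    using supp by blast
  then have "measure_pmf.prob \<phi> {K. A \<subseteq> K} = measure_pmf.prob \<phi> ?F"
    by (metis measure_Int_set_pmf)
  also have "\<dots> = (\<Sum>I\<in>?F. pmf \<phi> I)"
    by (intro measure_measure_pmf_finite) auto
  also have "\<dots> = (\<Sum>I\<in>?F. minor (column_kernel Z) I)"
    using assms(2) by (intro sum.cong) (auto simp: determinantal_process_def minor_column_kernel)
  also have "\<dots> = minor (column_kernel Z) A"
    using sum_minors[OF projection_kernel_column_kernel[OF assms(1)] assms(3)] .
  finally show ?thesis .
qed

definition misses :: "'a set set \<Rightarrow> 'a set set" where
  "misses X = {K. \<forall>C\<in>X. \<not> C \<subseteq> K}"

abbreviation miss_prob :: "'a set pmf \<Rightarrow> 'a set set \<Rightarrow> real" where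
  "miss_prob \<phi> X \<equiv> measure_pmf.prob \<phi> (misses X)"

lemma miss_prob_antimono: "X \<subseteq> Y \<Longrightarrow> miss_prob \<phi> Y \<le> miss_prob \<phi> X"
  by (intro measure_pmf.finite_measure_mono) (auto simp: misses_def)

text \<open>
  Negative correlation without conditioning.  By complementation it is Fischer's inequality.
\<close>
lemma miss_prob_pair_le:
  assumes "orthonormal_family N Z" and "determinantal_process N Z \<phi>"
    and "A \<subseteq> {1..N}" and "B \<subseteq> {1..N}" and "A \<inter> B = {}"
  shows "miss_prob \<phi> {A, B} \<le> miss_prob \<phi> {A} * miss_prob \<phi> {B}"
proof -
  let ?P = "measure_pmf.prob \<phi>"
  let ?a = "?P {K. A \<subseteq> K}" and ?b = "?P {K. B \<subseteq> K}" and ?ab = "?P {K. A \<union> B \<subseteq> K}"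
  have ab: "?ab \<le> ?a * ?b"
    using minor_Un_le[OF projection_kernel_column_kernel[OF assms(1)] assms(3-5)]
      determinantal_process_prob_superset[OF assms(1,2) assms(3)]
      determinantal_process_prob_superset[OF assms(1,2) assms(4)]
      determinantal_process_prob_superset[OF assms(1,2) Un_least[OF assms(3,4)]] by simp
  have single: "miss_prob \<phi> {A} = 1 - ?a" "miss_prob \<phi> {B} = 1 - ?b"
    using measure_pmf.prob_compl[of "{K. A \<subseteq> K}" \<phi>] measure_pmf.prob_compl[of "{K. B \<subseteq> K}" \<phi>]
    by (simp_all add: misses_def set_diff_eq)
  have pair: "miss_prob \<phi> {A, B} = 1 - (?a + ?b - ?ab)"
  proof -
    have "misses {A, B} = UNIV - ({K. A \<subseteq> K} \<union> {K. B \<subseteq> K})"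
      by (auto simp: misses_def)
    moreover have "{K. A \<subseteq> K} \<inter> {K. B \<subseteq> K} = {K. A \<union> B \<subseteq> K}"
      by auto
    then have "?P ({K. A \<subseteq> K} \<union> {K. B \<subseteq> K}) = ?a + ?b - ?ab"
      using measure_pmf.finite_measure_Union'[of "{K. A \<subseteq> K}" \<phi> "{K. B \<subseteq> K}"]
        measure_pmf.finite_measure_Diff'[of "{K. B \<subseteq> K}" \<phi> "{K. A \<subseteq> K}"]
      by (simp add: Int_commute)
    ultimately show ?thesis
      using measure_pmf.prob_compl[of "{K. A \<subseteq> K} \<union> {K. B \<subseteq> K}" \<phi>] by simp
  qed
  have "1 - (x + y - z) \<le> (1 - x) * (1 - y)" if "z \<le> x * y" for x y z :: real
    using that by (simp add: algebra_simps)
  then show ?thesis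
    unfolding single pair using ab by blast
qed

text \<open>
  Negative correlation given a nonempty family: the assumed property, stated for an enumeration of
  \<open>insert B T\<close> and cleared of denominators.
\<close>
lemma miss_prob_insert_insert_le:
  assumes cond: "conditional_correlation_property N \<phi>"
    and sub: "\<Union> (insert A (insert B T)) \<subseteq> {1..N}"
    and disj: "pairwise disjnt (insert A (insert B T))"
    and "finite T" and "T \<noteq> {}" and "A \<notin> T" and "B \<notin> T" and "A \<noteq> B"
  shows "miss_prob \<phi> (insert A (insert B T)) * miss_prob \<phi> T
    \<le> miss_prob \<phi> (insert A T) * miss_prob \<phi> (insert B T)"
proof (cases "miss_prob \<phi> (insert B T) = 0")
  case True
  then have "miss_prob \<phi> (insert A (insert B T)) = 0"
    using miss_prob_antimono[of "insert B T" "insert A (insert B T)" \<phi>]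
    by (simp add: subset_insertI measure_le_0_iff)
  then show ?thesis
    by simp
next
  case False
  then have pos: "0 < miss_prob \<phi> (insert B T)"
    by (simp add: zero_less_measure_iff)
  then have posT: "0 < miss_prob \<phi> T"
    using miss_prob_antimono[of T "insert B T" \<phi>] by (simp add: subset_insertI less_le_trans)
  define m where "m = card T"
  obtain h where h: "bij_betw h {1..m} T"
    using ex_bij_betw_nat_finite_1[OF \<open>finite T\<close>] unfolding m_def by blast
  \<comment> \<open>The set \<open>B\<close> comes last, since the property compares conditioning with and without the last set.\<close>
  define As where "As i = (if i \<le> m then h i else B)" for i
  have m: "1 \<le> m"
    using \<open>finite T\<close> \<open>T \<noteq> {}\<close> by (simp add: m_def Suc_le_eq card_gt_0_iff)
  have imT: "As ` {1..m} = T"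
    using h by (auto simp: As_def bij_betw_def)
  have imBT: "As ` {1..Suc m} = insert B T"
  proof -
    have "{1..Suc m} = insert (Suc m) {1..m}"
      by auto
    moreover have "As (Suc m) = B"
      by (simp add: As_def)
    ultimately show ?thesis
      using imT by (simp only: image_insert)
  qed
  have inj: "inj_on As {1..Suc m}"
  proof -
    have "card (As ` {1..Suc m}) = card {1..Suc m}"
      unfolding imBT using \<open>finite T\<close> \<open>B \<notin> T\<close> by (simp add: m_def)
    then show ?thesis
      by (intro eq_card_imp_inj_on) simp_all
  qed
  have fam: "disjoint_family_on As {1..Suc m}"
    unfolding disjoint_family_on_def
  proof (intro ballI impI)
    fix i j assume ij: "i \<in> {1..Suc m}" "j \<in> {1..Suc m}" "i \<noteq> j"
    then have "As i \<noteq> As j"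
      using inj by (simp only: inj_on_eq_iff not_False_eq_True)
    moreover have "As i \<in> insert B T" "As j \<in> insert B T"
      using ij imBT by blast+
    ultimately show "As i \<inter> As j = {}"
      by (intro pairwiseD[OF disj insertI2 insertI2, unfolded disjnt_def])
  qed
  have qT: "(\<forall>i\<in>{1..m}. \<not> As i \<subseteq> K) \<longleftrightarrow> K \<in> misses T" for K
    unfolding imT[symmetric] misses_def by blast
  have qBT: "(\<forall>i\<in>{1..Suc m}. \<not> As i \<subseteq> K) \<longleftrightarrow> K \<in> misses (insert B T)" for K
    unfolding imBT[symmetric] misses_def by blast
  have AC: "C \<subseteq> {1..N}" "A \<inter> C = {}" if "C \<in> insert B T" for C
  proof -
    have "A \<noteq> C"
      using that assms(6,8) by blast
    then show "A \<inter> C = {}"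
      using that by (intro pairwiseD[OF disj insertI1 insertI2, unfolded disjnt_def])
    show "C \<subseteq> {1..N}"
      using sub that by blast
  qed
  have "As i \<in> insert B T" if "i \<in> {1..Suc m}" for i
    using that imBT by blast
  then have "\<forall>i\<in>{1..Suc m}. As i \<subseteq> {1..N}" "\<forall>i\<in>{1..Suc m}. A \<inter> As i = {}"
    using AC by blast+
  moreover have "0 < \<P>(K in measure_pmf \<phi>. \<forall>i\<in>{1..Suc m}. \<not> As i \<subseteq> K)"
    using pos unfolding qBT by simp
  moreover have "A \<subseteq> {1..N}" "2 \<le> Suc m"
    using sub m by auto
  ultimately have "\<P>(K in measure_pmf \<phi>. \<not> A \<subseteq> K \<bar> \<forall>i\<in>{1..Suc m}. \<not> As i \<subseteq> K)
      \<le> \<P>(K in measure_pmf \<phi>. \<not> A \<subseteq> K \<bar> \<forall>i\<in>{1..Suc m - 1}. \<not> As i \<subseteq> K)"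
    using cond[unfolded conditional_correlation_property_def, rule_format, of "Suc m" A As] fam
    by simp
  moreover have "\<P>(K in measure_pmf \<phi>. \<not> A \<subseteq> K \<bar> K \<in> misses X)
      = miss_prob \<phi> (insert A X) / miss_prob \<phi> X" for X
  proof -
    have "{K. \<not> A \<subseteq> K \<and> K \<in> misses X} = misses (insert A X)"
      by (auto simp: misses_def)
    then show ?thesis
      by (simp add: cond_prob_def)
  qed
  ultimately have "miss_prob \<phi> (insert A (insert B T)) / miss_prob \<phi> (insert B T)
      \<le> miss_prob \<phi> (insert A T) / miss_prob \<phi> T"
    unfolding qBT diff_Suc_1 qT by simp
  then show ?thesis
    using pos posT by (simp add: field_simps)
qed

section \<open>From pairs to families\<close>

text \<open>
  Log-submodularity of \<open>f\<close> on the subsets of \<open>F\<close>, in its local form; without denominators it also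
  makes sense where \<open>f\<close> vanishes.
\<close>
definition negatively_correlated :: "'a set \<Rightarrow> ('a set \<Rightarrow> real) \<Rightarrow> bool" where
  "negatively_correlated F f \<longleftrightarrow>
     (\<forall>T x y. insert x (insert y T) \<subseteq> F \<longrightarrow> x \<noteq> y \<longrightarrow> x \<notin> T \<longrightarrow> y \<notin> T \<longrightarrow>
        f (insert x (insert y T)) * f T \<le> f (insert x T) * f (insert y T))"

text \<open>
  Multiplication of the two inequalities \<open>p / c \<le> d / b\<close> and \<open>c / b \<le> e / t\<close>, where no denominator
  needs to be positive because \<open>p \<le> b\<close>.
\<close>
lemma chain_rule_le:
  fixes b c d e p t :: real
  assumes "p * b \<le> c * d" and "c * t \<le> e * b" and "p \<le> b"
    and "0 \<le> p" and "0 \<le> d" and "0 \<le> e" and "0 \<le> t"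
  shows "p * t \<le> e * d"
proof (cases "b = 0")
  case True
  then show ?thesis
    using assms by (simp add: mult_nonneg_nonneg)
next
  case False
  then have "0 < b"
    using assms by simp
  have "(p * t) * b \<le> (c * t) * d"
    using mult_right_mono[OF assms(1,7)] by (simp add: mult_ac)
  also have "\<dots> \<le> (e * d) * b"
    using mult_right_mono[OF assms(2,5)] by (simp add: mult_ac)
  finally show ?thesis
    using \<open>0 < b\<close> by simp
qed

text \<open>
  The global form follows by enlarging \<open>Y\<close> and then \<open>X\<close> by one element at a time; in each step
  the new element is moved into \<open>T\<close> for the induction hypothesis.
\<close>
lemma negatively_correlated_Un:
  assumes "negatively_correlated F f"
    and anti: "\<And>X Y. X \<subseteq> Y \<Longrightarrow> f Y \<le> f X" and nonneg: "\<And>X. 0 \<le> f X"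
    and "finite X" and "finite Y" and "T \<union> X \<union> Y \<subseteq> F"
    and "X \<inter> Y = {}" and "X \<inter> T = {}" and "Y \<inter> T = {}"
  shows "f (T \<union> X \<union> Y) * f T \<le> f (T \<union> X) * f (T \<union> Y)"
proof -
  have single: "f (insert x (T \<union> Y)) * f T \<le> f (insert x T) * f (T \<union> Y)"
    if "finite Y" "insert x (T \<union> Y) \<subseteq> F" "x \<notin> Y" "x \<notin> T" "Y \<inter> T = {}" for x T Y
    using that
  proof (induction Y arbitrary: T rule: finite_induct)
    case empty
    show ?case by simp
  next
    case (insert y Y)
    have IH: "f (insert x (insert y T \<union> Y)) * f (insert y T)
        \<le> f (insert x (insert y T)) * f (insert y T \<union> Y)"
      using insert by (intro insert.IH) auto
    have "f (insert x (insert y T)) * f T \<le> f (insert x T) * f (insert y T)"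
      using assms(1) insert.prems unfolding negatively_correlated_def by blast
    then have "f (insert x (insert y T \<union> Y)) * f T \<le> f (insert x T) * f (insert y T \<union> Y)"
      using chain_rule_le[OF IH _ anti] nonneg by blast
    then show ?case
      by simp
  qed
  show ?thesis
    using assms(4,6-9)
  proof (induction X arbitrary: T rule: finite_induct)
    case empty
    show ?case by (simp add: mult.commute)
  next
    case (insert x X)
    have IH: "f (insert x T \<union> X \<union> Y) * f (insert x T)
        \<le> f (insert x T \<union> Y) * f (insert x T \<union> X)"
      using insert.IH[of "insert x T"] insert.prems insert.hyps by (auto simp: mult.commute)
    have "f (insert x T \<union> Y) * f T \<le> f (T \<union> Y) * f (insert x T)"
      using single[OF assms(5), of x T] insert.prems by (auto simp: mult.commute)
    then have "f (insert x T \<union> X \<union> Y) * f T \<le> f (T \<union> Y) * f (insert x T \<union> X)"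
      using chain_rule_le[OF IH _ anti] nonneg by blast
    then show ?case
      by (simp add: mult.commute)
  qed
qed

lemma miss_prob_empty: "miss_prob \<phi> {} = 1"
  by (simp add: misses_def)

text \<open>
  The determinantal law covers the empty conditioning family, the assumed property all others.
\<close>
lemma negatively_correlated_miss_prob:
  assumes "orthonormal_family N Z" and "determinantal_process N Z \<phi>"
    and "conditional_correlation_property N \<phi>"
    and F: "\<Union> F \<subseteq> {1..N}" "pairwise disjnt F"
  shows "negatively_correlated F (miss_prob \<phi>)"
  unfolding negatively_correlated_def
proof (intro allI impI)
  fix T A B
  assume sub: "insert A (insert B T) \<subseteq> F" and ne: "A \<noteq> B" "A \<notin> T" "B \<notin> T"
  have AB: "A \<subseteq> {1..N}" "B \<subseteq> {1..N}"
    using sub F(1) by blast+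
  have "A \<inter> B = {}"
    using pairwiseD[OF F(2), of A B] sub ne(1) by (simp add: disjnt_def)
  note disj = this
  show "miss_prob \<phi> (insert A (insert B T)) * miss_prob \<phi> T
      \<le> miss_prob \<phi> (insert A T) * miss_prob \<phi> (insert B T)"
  proof (cases "T = {}")
    case True
    then show ?thesis
      using miss_prob_pair_le[OF assms(1,2) AB disj] True by (simp add: miss_prob_empty)
  next
    case False
    have U: "\<Union> (insert A (insert B T)) \<subseteq> {1..N}"
      using sub F(1) by blast
    moreover have "finite T"
      using U by (intro finite_subset[of T "Pow {1..N}"]) auto
    moreover have "pairwise disjnt (insert A (insert B T))"
      using pairwise_subset[OF F(2) sub] .
    ultimately show ?thesis
      by (intro miss_prob_insert_insert_le[OF assms(3)]) (use False ne in simp_all)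
  qed
qed

section \<open>The disjoint occurrence inequality\<close>

definition hits :: "'a set set \<Rightarrow> 'a set set" where
  "hits X = {K. \<exists>C\<in>X. C \<subseteq> K}"

text \<open>
  For families of nonempty, pairwise disjoint sets this is the disjoint intersection of the events
  generated by \<open>X\<close> and \<open>Y\<close>.
\<close>
definition hits_distinct :: "'a set set \<Rightarrow> 'a set set \<Rightarrow> 'a set set" where
  "hits_distinct X Y = {K. \<exists>C\<in>X. \<exists>D\<in>Y. C \<noteq> D \<and> C \<subseteq> K \<and> D \<subseteq> K}"

lemma prob_hits_misses:
  "measure_pmf.prob \<phi> (hits X \<inter> misses T) = miss_prob \<phi> T - miss_prob \<phi> (T \<union> X)"
proof -
  have "hits X \<inter> misses T = misses T - misses (T \<union> X)"
    by (auto simp: hits_def misses_def)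
  then show ?thesis
    by (simp add: measure_pmf.finite_measure_Diff misses_def subset_iff)
qed

lemma prob_Un_Int:
  "measure_pmf.prob \<phi> (A \<union> B) + measure_pmf.prob \<phi> (A \<inter> B)
    = measure_pmf.prob \<phi> A + measure_pmf.prob \<phi> B"
  using measure_pmf.finite_measure_Union'[of A \<phi> B] measure_pmf.finite_measure_Diff'[of B \<phi> A]
  by (simp add: Int_commute)

text \<open>
  The arithmetic of the induction step.  Up to the common factor \<open>r + q\<close>, the numbers \<open>r\<close> and \<open>q\<close>
  are the probabilities that the common generator is hit and missed.  On the event that it is missed,
  \<open>a\<close>, \<open>b\<close>, \<open>u\<close> and \<open>s\<close> belong to hitting \<open>X\<close>, \<open>Y\<close>, one of them, and both disjointly; \<open>o'\<close> belongs to
  hitting the common generator together with a further one.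
\<close>
lemma disjoint_occurrence_step:
  fixes r q a b s u o' :: real
  assumes "o' \<le> r" and "o' * q \<le> r * u" and "s * q \<le> a * b" and "u + s \<le> a + b" and "0 \<le> r"
  shows "(s + o') * (r + q) \<le> (r + a) * (r + b)"
proof -
  have "o' * r \<le> r * r"
    using assms by (intro mult_right_mono)
  moreover have "r * (u + s) \<le> r * (a + b)"
    using assms by (intro mult_left_mono)
  ultimately show ?thesis
    using assms(2,3) by (simp add: algebra_simps)
qed

text \<open>
  The inequality for conditional probabilities given that \<open>T\<close> is missed, multiplied by the square
  of the probability of that event.  A common generator \<open>c\<close> is sufficient for both events but must
  not be used twice.  If \<open>c\<close> is missed it can join \<open>T\<close>, which is why the induction runs over all \<open>T\<close>;
  if it is hit, any further generator completes the disjoint occurrence.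
\<close>
lemma prob_hits_distinct_le:
  assumes nc: "negatively_correlated F (miss_prob \<phi>)"
    and "finite X" and "finite Y" and "X \<union> Y \<union> T \<subseteq> F" and "X \<inter> T = {}" and "Y \<inter> T = {}"
  shows "measure_pmf.prob \<phi> (hits_distinct X Y \<inter> misses T) * miss_prob \<phi> T
    \<le> measure_pmf.prob \<phi> (hits X \<inter> misses T) * measure_pmf.prob \<phi> (hits Y \<inter> misses T)"
  using assms(2-6)
proof (induction "card (X \<inter> Y)" arbitrary: X Y T)
  case 0
  let ?f = "miss_prob \<phi>"
  have disj: "X \<inter> Y = {}"
    using 0 by simp
  have "?f (T \<union> X \<union> Y) * ?f T \<le> ?f (T \<union> X) * ?f (T \<union> Y)"
    using 0 disj by (intro negatively_correlated_Un[OF nc] miss_prob_antimono) auto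
  moreover have "measure_pmf.prob \<phi> (hits_distinct X Y \<inter> misses T)
      \<le> ?f T - ?f (T \<union> X) - ?f (T \<union> Y) + ?f (T \<union> X \<union> Y)"
  proof -
    have "measure_pmf.prob \<phi> (hits_distinct X Y \<inter> misses T)
        \<le> measure_pmf.prob \<phi> ((hits X \<inter> misses T) \<inter> (hits Y \<inter> misses T))"
      by (intro measure_pmf.finite_measure_mono) (auto simp: hits_distinct_def hits_def)
    moreover have "(hits X \<inter> misses T) \<union> (hits Y \<inter> misses T) = hits (X \<union> Y) \<inter> misses T"
      by (auto simp: hits_def)
    ultimately show ?thesis
      using prob_Un_Int[of \<phi> "hits X \<inter> misses T" "hits Y \<inter> misses T"]
      by (simp add: prob_hits_misses Un_assoc)
  qed
  then have "measure_pmf.prob \<phi> (hits_distinct X Y \<inter> misses T) * ?f T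
      \<le> (?f T - ?f (T \<union> X) - ?f (T \<union> Y) + ?f (T \<union> X \<union> Y)) * ?f T"
    by (intro mult_right_mono) simp_all
  ultimately show ?case
    unfolding prob_hits_misses by (simp add: algebra_simps)
next
  case (Suc n)
  let ?f = "miss_prob \<phi>"
  let ?P = "measure_pmf.prob \<phi>"
  obtain c where c: "c \<in> X" "c \<in> Y"
    using Suc.hyps(2) by (metis Int_iff card.empty all_not_in_conv nat.distinct(1))
  define X' where "X' = X - {c}"
  define Y' where "Y' = Y - {c}"
  define T' where "T' = insert c T"
  have XY: "X = insert c X'" "Y = insert c Y'" "c \<notin> X'" "c \<notin> Y'"
    using c by (auto simp: X'_def Y'_def)
  have fin: "finite X'" "finite Y'"
    using Suc.prems by (simp_all add: X'_def Y'_def)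
  define r where "r = ?f T - ?f T'"
  define a where "a = ?P (hits X' \<inter> misses T')"
  define b where "b = ?P (hits Y' \<inter> misses T')"
  define s where "s = ?P (hits_distinct X' Y' \<inter> misses T')"
  define u where "u = ?P (hits (X' \<union> Y') \<inter> misses T')"
  define o' where "o' = ?P (hits (X' \<union> Y') \<inter> misses T - hits (X' \<union> Y') \<inter> misses T')"
  have o': "o' = ?P (hits (X' \<union> Y') \<inter> misses T) - u"
    unfolding o'_def u_def
    by (intro measure_pmf.finite_measure_Diff) (auto simp: misses_def T'_def)
  have mono: "?f T' \<le> ?f T" "?f (T' \<union> (X' \<union> Y')) \<le> ?f (T \<union> (X' \<union> Y'))"
    by (intro miss_prob_antimono; auto simp: T'_def)+
  have "X \<inter> Y = insert c (X' \<inter> Y')" "c \<notin> X' \<inter> Y'"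
    using XY by auto
  then have card: "n = card (X' \<inter> Y')"
    using Suc.hyps(2) fin by simp
  \<comment> \<open>Missing \<open>c\<close> makes it a member of the conditioning family.\<close>
  have IH: "s * ?f T' \<le> a * b"
    unfolding s_def a_def b_def
    by (rule Suc.hyps(1)[OF card fin]) (use Suc.prems XY in \<open>auto simp: T'_def\<close>)
  have "?f (T \<union> {c} \<union> (X' \<union> Y')) * ?f T \<le> ?f (T \<union> {c}) * ?f (T \<union> (X' \<union> Y'))"
    using Suc.prems XY fin
    by (intro negatively_correlated_Un[OF nc] miss_prob_antimono) auto
  then have NC: "?f (T' \<union> (X' \<union> Y')) * ?f T \<le> ?f T' * ?f (T \<union> (X' \<union> Y'))"
    by (simp add: T'_def)
  have "?P (hits_distinct X Y \<inter> misses T) \<le> s + o'"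
  proof -
    have "hits_distinct X Y \<inter> misses T \<subseteq> (hits_distinct X' Y' \<inter> misses T') \<union>
        (hits (X' \<union> Y') \<inter> misses T - hits (X' \<union> Y') \<inter> misses T')"
    proof
      fix K assume "K \<in> hits_distinct X Y \<inter> misses T"
      then obtain C D where CD: "C \<in> X" "D \<in> Y" "C \<noteq> D" "C \<subseteq> K" "D \<subseteq> K"
        and K: "K \<in> misses T"
        unfolding hits_distinct_def by blast
      show "K \<in> (hits_distinct X' Y' \<inter> misses T') \<union>
          (hits (X' \<union> Y') \<inter> misses T - hits (X' \<union> Y') \<inter> misses T')"
      proof (cases "c \<subseteq> K")
        case True
        then have "K \<notin> misses T'"
          by (simp add: misses_def T'_def)
        moreover have "C \<in> X' \<or> D \<in> Y'"
          using CD(1-3) XY by blast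
        then have "K \<in> hits (X' \<union> Y')"
          using CD(4,5) unfolding hits_def by blast
        ultimately show ?thesis
          using K by blast
      next
        case False
        then have "K \<in> misses T'"
          using K by (simp add: misses_def T'_def)
        moreover have "C \<in> X'" "D \<in> Y'"
          using CD False XY by blast+
        then have "K \<in> hits_distinct X' Y'"
          using CD(3-5) unfolding hits_distinct_def by blast
        ultimately show ?thesis
          by blast
      qed
    qed
    then have "?P (hits_distinct X Y \<inter> misses T) \<le> ?P ((hits_distinct X' Y' \<inter> misses T') \<union>
        (hits (X' \<union> Y') \<inter> misses T - hits (X' \<union> Y') \<inter> misses T'))"
      by (intro measure_pmf.finite_measure_mono) simp_all
    also have "\<dots> \<le> s + o'"
      unfolding s_def o'_def by (intro measure_Un_le) simp_all
    finally show ?thesis .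
  qed
  then have "?P (hits_distinct X Y \<inter> misses T) * ?f T \<le> (s + o') * (r + ?f T')"
    unfolding r_def by (simp add: mult_right_mono)
  also have "\<dots> \<le> (r + a) * (r + b)"
  proof (rule disjoint_occurrence_step[OF _ _ IH])
    show "o' \<le> r" "0 \<le> r"
      using mono by (simp_all add: o' u_def r_def prob_hits_misses)
    show "o' * ?f T' \<le> r * u"
      using NC by (simp add: o' u_def r_def prob_hits_misses algebra_simps)
    \<comment> \<open>Disjoint occurrence implies joint occurrence, so inclusion-exclusion bounds \<open>u\<close> and \<open>s\<close> together.\<close>
    have "s \<le> ?P ((hits X' \<inter> misses T') \<inter> (hits Y' \<inter> misses T'))"
      unfolding s_def
      by (intro measure_pmf.finite_measure_mono) (auto simp: hits_distinct_def hits_def)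
    moreover have "(hits X' \<inter> misses T') \<union> (hits Y' \<inter> misses T') = hits (X' \<union> Y') \<inter> misses T'"
      by (auto simp: hits_def)
    ultimately show "u + s \<le> a + b"
      using prob_Un_Int[of \<phi> "hits X' \<inter> misses T'" "hits Y' \<inter> misses T'"]
      unfolding a_def b_def u_def by simp
  qed
  also have "\<dots> = ?P (hits X \<inter> misses T) * ?P (hits Y \<inter> misses T)"
    using XY by (simp add: prob_hits_misses r_def a_def b_def T'_def)
  finally show ?case .
qed

section \<open>Generators of increasing events\<close>

lemma minimal_element_exists:
  assumes "increasing_event N \<AA>" and "A \<in> \<AA>"
  shows "\<exists>C\<in>minimal_elements \<AA>. C \<subseteq> A"
proof -
  have "\<AA> \<subseteq> Pow {1..N}"
    using assms(1) unfolding increasing_event_def by (rule conjunct1)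
  then have "finite \<AA>"
    by (rule finite_subset) simp
  then obtain C where "C \<in> \<AA>" "C \<subseteq> A" "\<forall>B\<in>\<AA>. B \<subseteq> C \<longrightarrow> C = B"
    using finite_has_minimal2[OF _ assms(2)] by metis
  then have "C \<in> minimal_elements \<AA>"
    unfolding minimal_elements_def by (simp add: eq_commute)
  then show ?thesis
    using \<open>C \<subseteq> A\<close> by (rule bexI[rotated])
qed

lemma increasing_event_superset:
  assumes "increasing_event N \<AA>" and "A \<in> \<AA>" and "A \<subseteq> K" and "K \<subseteq> {1..N}"
  shows "K \<in> \<AA>"
proof -
  have "A \<union> D \<in> \<AA>" if "finite D" "D \<subseteq> {1..N}" for D
    using that
  proof (induction D rule: finite_induct)
    case empty
    then show ?case using assms(2) by simp
  next
    case (insert n D)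
    then have "(A \<union> D) \<union> {n} \<in> \<AA>"
      using assms(1) unfolding increasing_event_def by blast
    then show ?case by simp
  qed
  from this[of K] show ?thesis
    using assms(3,4) finite_subset by (metis finite_atLeastAtMost sup.absorb2)
qed

lemma disjoint_intersection_subset_hits_distinct:
  assumes "increasing_event N \<AA>" and "increasing_event N \<BB>"
  shows "disjoint_intersection N \<AA> \<BB> \<subseteq> hits_distinct (minimal_elements \<AA>) (minimal_elements \<BB>)"
proof
  fix K assume "K \<in> disjoint_intersection N \<AA> \<BB>"
  then obtain L M where LM: "L \<in> \<AA>" "M \<in> \<BB>" "L \<inter> M = {}" "L \<union> M \<subseteq> K"
    unfolding disjoint_intersection_def by blast
  obtain C D where CD: "C \<in> minimal_elements \<AA>" "C \<subseteq> L" "D \<in> minimal_elements \<BB>" "D \<subseteq> M"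
    using minimal_element_exists[OF assms(1) LM(1)] minimal_element_exists[OF assms(2) LM(2)] by blast
  moreover have "C \<noteq> {}"
    using CD(1) assms(1) unfolding minimal_elements_def increasing_event_def by blast
  ultimately have "C \<noteq> D" "C \<subseteq> K" "D \<subseteq> K"
    using LM by blast+
  then show "K \<in> hits_distinct (minimal_elements \<AA>) (minimal_elements \<BB>)"
    using CD unfolding hits_distinct_def by blast
qed

lemma prob_cond_pmf:
  assumes "set_pmf \<phi> \<inter> E \<noteq> {}"
  shows "measure_pmf.prob (cond_pmf \<phi> E) A = measure_pmf.prob \<phi> (A \<inter> E) / measure_pmf.prob \<phi> E"
proof -
  have "emeasure (measure_pmf \<phi>) E \<noteq> 0"
    using assms measure_pmf_zero_iff[of \<phi> E] by (simp add: measure_pmf.emeasure_eq_measure)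
  then show ?thesis
    by (simp add: cond_pmf.rep_eq[OF assms] measure_uniform_measure Int_commute)
qed

theorem theorem2:
  fixes N p :: nat
    and Z :: "complex vec list"
    and \<phi> \<psi> :: "nat set pmf"
    and S\<^sub>1 S\<^sub>2 S T :: "nat set set"
    and \<AA> \<BB> :: "nat set set"
  assumes "1 < p" and "p < N"
    and "orthonormal_family N Z" and "length Z = p"
    and "determinantal_process N Z \<phi>"
    and "conditional_correlation_property N \<phi>"
    and "\<forall>C \<in> S\<^sub>1 \<union> S\<^sub>2 \<union> S \<union> T. C \<noteq> {} \<and> C \<subseteq> {1..N}"
    and "pairwise disjnt (S\<^sub>1 \<union> S\<^sub>2 \<union> S \<union> T)"
    and "\<P>(K in measure_pmf \<phi>. \<forall>D\<in>T. \<not> D \<subseteq> K) > 0"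
    and "increasing_event N \<AA>" and "minimal_elements \<AA> = S\<^sub>1 \<union> S"
    and "increasing_event N \<BB>" and "minimal_elements \<BB> = S\<^sub>2 \<union> S"
    and "\<psi> = conditioned_process \<phi> T"
  shows "\<P>(K in measure_pmf \<psi>. K \<in> disjoint_intersection N \<AA> \<BB>)
           \<le> \<P>(K in measure_pmf \<psi>. K \<in> \<AA>) * \<P>(K in measure_pmf \<psi>. K \<in> \<BB>)"
proof -
  let ?P = "measure_pmf.prob \<phi>"
  let ?f = "miss_prob \<phi> T"
  let ?F = "S\<^sub>1 \<union> S\<^sub>2 \<union> S \<union> T"
  \<comment> \<open>Generators that also belong to \<open>T\<close> are missed under the conditional law and can be discarded.\<close>
  define X where "X = S\<^sub>1 \<union> S - T"
  define Y where "Y = S\<^sub>2 \<union> S - T"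
  have F: "\<Union> ?F \<subseteq> {1..N}"
    using assms(7) by blast
  have finF: "finite ?F"
    using F by (intro finite_subset[of ?F "Pow {1..N}"]) auto
  have pos: "0 < ?f"
    using assms(9) by (simp add: misses_def)
  then have "set_pmf \<phi> \<inter> misses T \<noteq> {}"
    by (metis measure_pmf_zero_iff order_less_irrefl)
  then have \<psi>: "measure_pmf.prob \<psi> E = ?P (E \<inter> misses T) / ?f" for E
    unfolding assms(14) conditioned_process_def misses_def[symmetric] by (rule prob_cond_pmf)
  have nc: "negatively_correlated ?F (miss_prob \<phi>)"
    using negatively_correlated_miss_prob[OF assms(3,5,6) F assms(8)] .
  have main: "?P (hits_distinct X Y \<inter> misses T) * ?f
      \<le> ?P (hits X \<inter> misses T) * ?P (hits Y \<inter> misses T)"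
    using finF by (intro prob_hits_distinct_le[OF nc]) (auto simp: X_def Y_def)
  have increasing: "?P (hits (M - T) \<inter> misses T) \<le> ?P (\<EE> \<inter> misses T)"
    if "increasing_event N \<EE>" "minimal_elements \<EE> = M" for \<EE> M
  proof -
    have "set_pmf \<phi> \<subseteq> Pow {1..N}"
      using assms(5) unfolding determinantal_process_def by blast
    moreover have "M \<subseteq> \<EE>"
      using that(2) unfolding minimal_elements_def by blast
    ultimately have "(hits (M - T) \<inter> misses T) \<inter> set_pmf \<phi> \<subseteq> \<EE> \<inter> misses T"
      using increasing_event_superset[OF that(1)] unfolding hits_def by blast
    then have "?P ((hits (M - T) \<inter> misses T) \<inter> set_pmf \<phi>) \<le> ?P (\<EE> \<inter> misses T)"
      by (intro measure_pmf.finite_measure_mono) simp_all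
    then show ?thesis
      by (simp only: measure_Int_set_pmf)
  qed
  have "disjoint_intersection N \<AA> \<BB> \<inter> misses T \<subseteq> hits_distinct X Y \<inter> misses T"
  proof
    fix K assume "K \<in> disjoint_intersection N \<AA> \<BB> \<inter> misses T"
    then have K: "K \<in> misses T" and "K \<in> hits_distinct (S\<^sub>1 \<union> S) (S\<^sub>2 \<union> S)"
      using disjoint_intersection_subset_hits_distinct[OF assms(10,12)]
      unfolding assms(11,13) by blast+
    then obtain C D where CD: "C \<in> S\<^sub>1 \<union> S" "D \<in> S\<^sub>2 \<union> S" "C \<noteq> D" "C \<subseteq> K" "D \<subseteq> K"
      unfolding hits_distinct_def by blast
    have "C \<notin> T" "D \<notin> T"
      using K CD(4,5) unfolding misses_def by blast+
    then have "C \<in> X" "D \<in> Y"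
      using CD(1,2) by (simp_all add: X_def Y_def)
    then have "K \<in> hits_distinct X Y"
      using CD(3-5) unfolding hits_distinct_def by blast
    then show "K \<in> hits_distinct X Y \<inter> misses T"
      using K by blast
  qed
  then have "?P (disjoint_intersection N \<AA> \<BB> \<inter> misses T) \<le> ?P (hits_distinct X Y \<inter> misses T)"
    by (intro measure_pmf.finite_measure_mono) simp_all
  then have "?P (disjoint_intersection N \<AA> \<BB> \<inter> misses T) * ?f
      \<le> ?P (hits_distinct X Y \<inter> misses T) * ?f"
    by (intro mult_right_mono) simp_all
  also note main
  also have "?P (hits X \<inter> misses T) * ?P (hits Y \<inter> misses T)
      \<le> ?P (\<AA> \<inter> misses T) * ?P (\<BB> \<inter> misses T)"
    using increasing[OF assms(10,11)] increasing[OF assms(12,13)]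
    by (intro mult_mono) (simp_all add: X_def Y_def)
  finally show ?thesis
    using pos by (simp add: \<psi> field_simps)
qed

end
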